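(* Let $\lambda_0,\lambda_1,\mu_0,\mu_1,\varepsilon,\varepsilon'\in\mathbb{R}$ and $r,r'\in\mathbb{Z}$ be such that $\lambda_0\varepsilon+\lambda_1r=-\hbar$ and $\mu_0\varepsilon'+\mu_1r'=\hbar'$. If $\lambda_0\varepsilon'+\lambda_1r'=0$ and $\mu_0\varepsilon+\mu_1r=0$, then $C^\infty_0(\mathbb{R}\times\mathbb{Z})$, with the left $\mathcal{C}_\hbar$-action $$(W\xi)(x,k)=\xi(x-\varepsilon,k-r),\quad (R\xi)(x,k)=e^{\lambda_0x+\lambda_1k}\xi(x,k),\quad (U\xi)(x,k)=(\lambda_0x+\lambda_1k)\xi(x,k)$$ and the right $\mathcal{C}_{\hbar'}$-action $$(\xi W)(x,k)=\xi(x-\varepsilon',k-r'),\quad (\xi R)(x,k)=e^{\mu_0x+\mu_1k}\xi(x,k),\quad (\xi U)(x,k)=(\mu_0x+\mu_1k)\xi(x,k)$$ (with $W^{-1},R^{-1}$ acting by the inverse operators), is a $\mathcal{C}_\hbar$-$\mathcal{C}_{\hbar'}$-bimodule, i.e. $A(\xi B)=(A\xi)B$ for all $A\in\mathcal{C}_\hbar$, $B\in\mathcal{C}_{\hbar'}$ and $\xi\in C^\infty_0(\mathbb{R}\times\mathbb{Z})$.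
   Context: Let $\hbar,\hbar'\in\mathbb{R}$. For real $\hbar$, $\mathcal{C}_\hbar$ is the unital associative $\mathbb{C}$-algebra with generators $U,R,R^{-1},W,W^{-1}$ and relations $WW^{-1}=W^{-1}W=1$, $RR^{-1}=R^{-1}R=1$, $RU=UR$, $R^{-1}U=UR^{-1}$, $WR=e^{\hbar}RW$, $WR^{-1}=e^{-\hbar}R^{-1}W$, $W^{-1}R=e^{-\hbar}RW^{-1}$, $W^{-1}R^{-1}=e^{\hbar}R^{-1}W^{-1}$, $WU=UW+\hbar W$, $W^{-1}U=UW^{-1}-\hbar W^{-1}$; $\mathcal{C}_{\hbar'}$ is the same with $\hbar'$ in place of $\hbar$. $C^\infty_0(\mathbb{R}\times\mathbb{Z})$ is the space of complex-valued smooth functions on $\mathbb{R}\times\mathbb{Z}$ with compact support (in both variables). *)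

theory Defs
  imports "HOL-Analysis.Analysis" "HOL-Library.Poly_Mapping"
    "HOL-Algebra.QuotRing" "HOL-Algebra.Algebraic_Closure_Type"
begin

section \<open>Modules and bimodules over complex algebras\<close>

text \<open>A unital associative complex algebra is given by a (not necessarily commutative) ring
  together with its structure map from the complex numbers into the centre; multiplication of
  an algebra element \<open>a\<close> by the scalar \<open>c\<close> is \<open>\<eta> c \<otimes> a\<close>.\<close>

locale complex_algebra = ring A for A :: "('a, 'm) ring_scheme" (structure) +
  fixes \<eta> :: "complex \<Rightarrow> 'a"
  assumes scalar_closed: "\<eta> c \<in> carrier A"
    and scalar_one: "\<eta> 1 = \<one>"
    and scalar_add: "\<eta> (c + d) = \<eta> c \<oplus> \<eta> d"
    and scalar_mult: "\<eta> (c * d) = \<eta> c \<otimes> \<eta> d"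
    and scalar_central: "a \<in> carrier A \<Longrightarrow> \<eta> c \<otimes> a = a \<otimes> \<eta> c"

text \<open>The modules considered here have as underlying vector space a space of complex-valued
  functions with pointwise operations.\<close>

locale function_space =
  fixes V :: "('s \<Rightarrow> complex) set"
  assumes zero_mem: "(\<lambda>p. 0) \<in> V"
    and add_mem: "\<xi> \<in> V \<Longrightarrow> \<zeta> \<in> V \<Longrightarrow> (\<lambda>p. \<xi> p + \<zeta> p) \<in> V"
    and scale_mem: "\<xi> \<in> V \<Longrightarrow> (\<lambda>p. c * \<xi> p) \<in> V"

locale left_algebra_module = complex_algebra A \<eta> + function_space V
  for A :: "('a, 'm) ring_scheme" (structure) and \<eta> and V :: "('s \<Rightarrow> complex) set" +
  fixes lact :: "'a \<Rightarrow> ('s \<Rightarrow> complex) \<Rightarrow> 's \<Rightarrow> complex"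
  assumes lact_closed: "a \<in> carrier A \<Longrightarrow> \<xi> \<in> V \<Longrightarrow> lact a \<xi> \<in> V"
    and lact_add_right: "a \<in> carrier A \<Longrightarrow> \<xi> \<in> V \<Longrightarrow> \<zeta> \<in> V \<Longrightarrow>
          lact a (\<lambda>p. \<xi> p + \<zeta> p) = (\<lambda>p. lact a \<xi> p + lact a \<zeta> p)"
    and lact_add_left: "a \<in> carrier A \<Longrightarrow> b \<in> carrier A \<Longrightarrow> \<xi> \<in> V \<Longrightarrow>
          lact (a \<oplus> b) \<xi> = (\<lambda>p. lact a \<xi> p + lact b \<xi> p)"
    and lact_mult: "a \<in> carrier A \<Longrightarrow> b \<in> carrier A \<Longrightarrow> \<xi> \<in> V \<Longrightarrow>
          lact (a \<otimes> b) \<xi> = lact a (lact b \<xi>)"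
    and lact_scalar: "\<xi> \<in> V \<Longrightarrow> lact (\<eta> c) \<xi> = (\<lambda>p. c * \<xi> p)"

locale right_algebra_module = complex_algebra B \<theta> + function_space V
  for B :: "('b, 'n) ring_scheme" (structure) and \<theta> and V :: "('s \<Rightarrow> complex) set" +
  fixes ract :: "('s \<Rightarrow> complex) \<Rightarrow> 'b \<Rightarrow> 's \<Rightarrow> complex"
  assumes ract_closed: "b \<in> carrier B \<Longrightarrow> \<xi> \<in> V \<Longrightarrow> ract \<xi> b \<in> V"
    and ract_add_left: "b \<in> carrier B \<Longrightarrow> \<xi> \<in> V \<Longrightarrow> \<zeta> \<in> V \<Longrightarrow>
          ract (\<lambda>p. \<xi> p + \<zeta> p) b = (\<lambda>p. ract \<xi> b p + ract \<zeta> b p)"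
    and ract_add_right: "a \<in> carrier B \<Longrightarrow> b \<in> carrier B \<Longrightarrow> \<xi> \<in> V \<Longrightarrow>
          ract \<xi> (a \<oplus> b) = (\<lambda>p. ract \<xi> a p + ract \<xi> b p)"
    and ract_mult: "a \<in> carrier B \<Longrightarrow> b \<in> carrier B \<Longrightarrow> \<xi> \<in> V \<Longrightarrow>
          ract \<xi> (a \<otimes> b) = ract (ract \<xi> a) b"
    and ract_scalar: "\<xi> \<in> V \<Longrightarrow> ract \<xi> (\<theta> c) = (\<lambda>p. c * \<xi> p)"

locale algebra_bimodule =
  left: left_algebra_module A \<eta> V lact + right: right_algebra_module B \<theta> V ract
  for A :: "('a, 'm) ring_scheme" and \<eta> and B :: "('b, 'n) ring_scheme" and \<theta>
    and V :: "('s \<Rightarrow> complex) set" and lact and ract +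
  assumes compatible: "a \<in> carrier A \<Longrightarrow> b \<in> carrier B \<Longrightarrow> \<xi> \<in> V \<Longrightarrow>
          lact a (ract \<xi> b) = ract (lact a \<xi>) b"


section \<open>The algebra presented by generators and relations\<close>

text \<open>Lists under concatenation form the free monoid. The monoid algebra of the free monoid,
  i.e. the type of finitely supported functions from words to the complex numbers with
  convolution product, is the free unital associative algebra.\<close>

instantiation list :: (type) monoid_add
begin

definition zero_list :: "'a list" where "0 = []"

definition plus_list :: "'a list \<Rightarrow> 'a list \<Rightarrow> 'a list" where "u + v = u @ v"

instance by standard (simp_all add: zero_list_def plus_list_def)

end

datatype gen = U | R | Rinv | W | Winv

type_synonym free_algebra = "gen list \<Rightarrow>\<^sub>0 complex"

abbreviation free_ring :: "free_algebra ring" where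
  "free_ring \<equiv> ring_of_type_algebra"

definition monomial :: "complex \<Rightarrow> gen list \<Rightarrow> free_algebra" where
  "monomial c w = Poly_Mapping.single w c"

text \<open>Each relation \<open>l = r\<close> is represented by the element \<open>l - r\<close> of the free algebra.\<close>

definition relators :: "real \<Rightarrow> free_algebra set" where
  "relators h =
    {monomial 1 [W, Winv] - 1,
     monomial 1 [Winv, W] - 1,
     monomial 1 [R, Rinv] - 1,
     monomial 1 [Rinv, R] - 1,
     monomial 1 [R, U] - monomial 1 [U, R],
     monomial 1 [Rinv, U] - monomial 1 [U, Rinv],
     monomial 1 [W, R] - monomial (of_real (exp h)) [R, W],
     monomial 1 [W, Rinv] - monomial (of_real (exp (- h))) [Rinv, W],
     monomial 1 [Winv, R] - monomial (of_real (exp (- h))) [R, Winv],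
     monomial 1 [Winv, Rinv] - monomial (of_real (exp h)) [Rinv, Winv],
     monomial 1 [W, U] - (monomial 1 [U, W] + monomial (of_real h) [W]),
     monomial 1 [Winv, U] - (monomial 1 [U, Winv] - monomial (of_real h) [Winv])}"

definition relation_ideal :: "real \<Rightarrow> free_algebra set" where
  "relation_ideal h = Idl\<^bsub>free_ring\<^esub> (relators h)"

definition C_alg :: "real \<Rightarrow> free_algebra set ring" where
  "C_alg h = free_ring Quot (relation_ideal h)"

definition C_class :: "real \<Rightarrow> free_algebra \<Rightarrow> free_algebra set" where
  "C_class h p = relation_ideal h +>\<^bsub>free_ring\<^esub> p"

definition C_scalar :: "real \<Rightarrow> complex \<Rightarrow> free_algebra set" where
  "C_scalar h c = C_class h (monomial c [])"

definition C_gen :: "real \<Rightarrow> gen \<Rightarrow> free_algebra set" where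
  "C_gen h g = C_class h (monomial 1 [g])"


section \<open>Test functions and the prescribed operators\<close>

definition smooth :: "(real \<Rightarrow> complex) \<Rightarrow> bool" where
  "smooth f \<longleftrightarrow>
    (\<forall>n t. ((\<lambda>g s. vector_derivative g (at s)) ^^ n) f differentiable (at t))"

text \<open>The integers carry the discrete topology, so smoothness on \<open>\<real> \<times> \<int>\<close> means
  smoothness on every component \<open>\<real> \<times> {k}\<close>.\<close>

definition test_functions :: "(real \<times> int \<Rightarrow> complex) set" where
  "test_functions =
    {\<xi>. (\<forall>k. smooth (\<lambda>x. \<xi> (x, k))) \<and> compact (closure {p. \<xi> p \<noteq> 0})}"

text \<open>\<open>T g\<close> is the operator by which the generator \<open>g\<close> acts on test functions.\<close>

definition prescribed_operators ::
  "real \<Rightarrow> int \<Rightarrow> real \<Rightarrow> real \<Rightarrow>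
   (gen \<Rightarrow> (real \<times> int \<Rightarrow> complex) \<Rightarrow> real \<times> int \<Rightarrow> complex) \<Rightarrow> bool"
where
  "prescribed_operators \<epsilon> r a b T \<longleftrightarrow>
    (\<forall>\<xi>\<in>test_functions.
      (\<forall>x k. T W \<xi> (x, k) = \<xi> (x - \<epsilon>, k - r)) \<and>
      (\<forall>x k. T R \<xi> (x, k) = of_real (exp (a * x + b * of_int k)) * \<xi> (x, k)) \<and>
      (\<forall>x k. T U \<xi> (x, k) = of_real (a * x + b * of_int k) * \<xi> (x, k)) \<and>
      T W (T Winv \<xi>) = \<xi> \<and> T Winv (T W \<xi>) = \<xi> \<and>
      T R (T Rinv \<xi>) = \<xi> \<and> T Rinv (T R \<xi>) = \<xi>)"

definition is_left_action ::
  "real \<Rightarrow> real \<Rightarrow> int \<Rightarrow> real \<Rightarrow> real \<Rightarrow>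
   (free_algebra set \<Rightarrow> (real \<times> int \<Rightarrow> complex) \<Rightarrow> real \<times> int \<Rightarrow> complex) \<Rightarrow> bool"
where
  "is_left_action h \<epsilon> r a b lact \<longleftrightarrow>
    left_algebra_module (C_alg h) (C_scalar h) test_functions lact \<and>
    prescribed_operators \<epsilon> r a b (\<lambda>g \<xi>. lact (C_gen h g) \<xi>)"

definition is_right_action ::
  "real \<Rightarrow> real \<Rightarrow> int \<Rightarrow> real \<Rightarrow> real \<Rightarrow>
   ((real \<times> int \<Rightarrow> complex) \<Rightarrow> free_algebra set \<Rightarrow> real \<times> int \<Rightarrow> complex) \<Rightarrow> bool"
where
  "is_right_action h \<epsilon> r a b ract \<longleftrightarrow>
    right_algebra_module (C_alg h) (C_scalar h) test_functions ract \<and>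
    prescribed_operators \<epsilon> r a b (\<lambda>g \<xi>. ract \<xi> (C_gen h g))"

end

theory Submission
  imports Defs
begin

text \<open>The prescribed operators extend to all complex functions on \<open>\<real> \<times> \<int>\<close>, so words in the
  generators, and hence the free algebra, act there: on the left through \<open>foldr\<close>, on the right
  through \<open>fold\<close>. Shifting by \<open>(\<epsilon>, r)\<close> changes the phase \<open>a x + b k\<close> by \<open>a \<epsilon> + b r\<close>; this being
  \<open>- h\<close> for the left action and \<open>h\<close> for the right one makes the relators act as zero, and both
  actions descend to the quotients. Conversely any action satisfying the requirements agrees with
  the constructed one on test functions, because \<open>W\<close> and \<open>R\<close> are onto there and so determine their
  inverses. The two remaining hypotheses say that each shift leaves the phase of the other
  action invariant, hence the generators of the two actions commute, and by bilinearity so do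
  all algebra elements.\<close>

section \<open>Linear extension of functions on words\<close>

definition lin_ext :: "('w \<Rightarrow> 'a) \<Rightarrow> ('w \<Rightarrow>\<^sub>0 'a::comm_ring_1) \<Rightarrow> 'a" where
  "lin_ext f p = (\<Sum>w\<in>Poly_Mapping.keys p. Poly_Mapping.lookup p w * f w)"

text \<open>Words outside the support contribute zero. Since supports may shrink under addition,
  sums over different supports are compared on a common finite superset.\<close>

lemma lin_ext_superset:
  assumes "finite S" "Poly_Mapping.keys p \<subseteq> S"
  shows "lin_ext f p = (\<Sum>w\<in>S. Poly_Mapping.lookup p w * f w)"
  unfolding lin_ext_def using assms
  by (intro sum.mono_neutral_left) (auto simp: in_keys_iff)

lemma lin_ext_add: "lin_ext f (p + q) = lin_ext f p + lin_ext f q"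
  using keys_add[of p q]
  by (simp add: lin_ext_superset[of "Poly_Mapping.keys p \<union> Poly_Mapping.keys q"] lookup_add algebra_simps sum.distrib)

lemma lin_ext_uminus: "lin_ext f (- p) = - lin_ext f p"
  by (simp add: lin_ext_def sum_negf keys_minus)

lemma lin_ext_diff: "lin_ext f (p - q) = lin_ext f p - lin_ext f q"
  using lin_ext_add[of f p "- q"] by (simp add: lin_ext_uminus)

lemma lin_ext_zero [simp]: "lin_ext f 0 = 0"
  by (simp add: lin_ext_def)

lemma lin_ext_single [simp]: "lin_ext f (Poly_Mapping.single w c) = c * f w"
  by (simp add: lin_ext_superset[of "{w}"])

text \<open>Reduces identities additive in an algebra element to single terms; zero is covered as a
  single term with coefficient 0.\<close>

lemma poly_mapping_add_induct [case_names single add]: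
  fixes p :: "'w \<Rightarrow>\<^sub>0 'a::comm_monoid_add"
  assumes single: "\<And>w c. P (Poly_Mapping.single w c)"
    and add: "\<And>p q. P p \<Longrightarrow> P q \<Longrightarrow> P (p + q)"
  shows "P p"
proof (induction p rule: update_induct)
  case const
  have "P (Poly_Mapping.single undefined 0)" by (rule single)
  then show ?case by simp
next
  case (update p w c)
  \<comment> \<open>The key \<open>w\<close> is not in the support of \<open>p\<close>, so
    overwriting its coefficient is the same as adding a term.\<close>
  then have "Poly_Mapping.update w c p = p + Poly_Mapping.single w c"
    by (intro poly_mapping_eqI) (auto simp: lookup_update lookup_add lookup_single in_keys_iff when_def)
  with update show ?case by (metis single add)
qed

lemma lin_ext_fun_add: "lin_ext (\<lambda>w. f w + g w) p = lin_ext f p + lin_ext g p"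
  by (simp add: lin_ext_def algebra_simps sum.distrib)

lemma lin_ext_fun_scale: "lin_ext (\<lambda>w. c * f w) p = c * lin_ext f p"
  by (simp add: lin_ext_def algebra_simps sum_distrib_left)

lemma lin_ext_swap:
  "lin_ext (\<lambda>u. lin_ext (\<lambda>v. f u v) q) p = lin_ext (\<lambda>v. lin_ext (\<lambda>u. f u v) p) q"
  unfolding lin_ext_def sum_distrib_left
  by (subst sum.swap) (simp add: algebra_simps)

text \<open>Both sides are additive in \<open>p\<close> and in \<open>q\<close>; on single terms the
  convolution product concatenates the two words.\<close>

lemma lin_ext_mult:
  fixes p q :: "'g list \<Rightarrow>\<^sub>0 'a::comm_ring_1"
  shows "lin_ext f (p * q) = lin_ext (\<lambda>u. lin_ext (\<lambda>v. f (u @ v)) q) p"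
proof (induction p rule: poly_mapping_add_induct)
  case (single u c)
  show ?case
  proof (induction q rule: poly_mapping_add_induct)
    case (single v d)
    show ?case by (simp add: mult_single plus_list_def mult_ac)
  next
    case (add p q)
    then show ?case by (simp add: lin_ext_add lin_ext_fun_add algebra_simps)
  qed
qed (simp add: lin_ext_add distrib_right)

section \<open>Actions of the free algebra on functions\<close>

definition linear_on_functions :: "(('s \<Rightarrow> complex) \<Rightarrow> 's \<Rightarrow> complex) \<Rightarrow> bool" where
  "linear_on_functions F \<longleftrightarrow>
    (\<forall>\<xi> \<zeta>. F (\<lambda>s. \<xi> s + \<zeta> s) = (\<lambda>s. F \<xi> s + F \<zeta> s)) \<and>
    (\<forall>c \<xi>. F (\<lambda>s. c * \<xi> s) = (\<lambda>s. c * F \<xi> s))"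

text \<open>At each point the argument is the same finite linear combination of the functions
  \<open>f w\<close>, so linearity moves \<open>F\<close> inside.\<close>

lemma linear_on_functions_lin_ext:
  assumes F: "linear_on_functions F"
  shows "F (\<lambda>s. lin_ext (\<lambda>w. f w s) p) = (\<lambda>s. lin_ext (\<lambda>w. F (f w) s) p)"
proof (induction p rule: poly_mapping_add_induct)
  case (single w c)
  show ?case using F by (simp add: linear_on_functions_def)
next
  case (add p q)
  then show ?case using F by (simp add: linear_on_functions_def lin_ext_add)
qed

text \<open>\<open>lin_ext\<close> is scalar valued, so the linear combination of operators is
  formed pointwise, at each \<open>s\<close> separately.\<close>

definition free_act ::
  "(gen list \<Rightarrow> ('s \<Rightarrow> complex) \<Rightarrow> 's \<Rightarrow> complex) \<Rightarrow> free_algebra \<Rightarrow> ('s \<Rightarrow> complex) \<Rightarrow> 's \<Rightarrow> complex"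
  where "free_act M p \<xi> = (\<lambda>s. lin_ext (\<lambda>w. M w \<xi> s) p)"

lemma linear_free_act:
  assumes "\<And>w. linear_on_functions (M w)"
  shows "linear_on_functions (free_act M p)"
  using assms unfolding free_act_def linear_on_functions_def
  by (simp add: lin_ext_fun_add lin_ext_fun_scale)

lemma free_act_mult:
  assumes "\<And>w. linear_on_functions (M w)" "\<And>u v \<xi>. M (u @ v) \<xi> = M u (M v \<xi>)"
  shows "free_act M (p * q) \<xi> = free_act M p (free_act M q \<xi>)"
  by (simp add: free_act_def lin_ext_mult assms(2) linear_on_functions_lin_ext[OF assms(1)])

text \<open>For a right action the left factor acts first, so the two sums come out in the opposite
  nesting and have to be exchanged.\<close>

lemma free_act_mult_rev:
  assumes "\<And>w. linear_on_functions (M w)" "\<And>u v \<xi>. M (u @ v) \<xi> = M v (M u \<xi>)"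
  shows "free_act M (p * q) \<xi> = free_act M q (free_act M p \<xi>)"
  unfolding free_act_def lin_ext_mult assms(2)
  by (subst lin_ext_swap) (simp add: linear_on_functions_lin_ext[OF assms(1)])

lemma free_act_commute:
  assumes "\<And>w. linear_on_functions (M w)" "\<And>w. linear_on_functions (N w)"
    and "\<And>u v \<xi>. M u (N v \<xi>) = N v (M u \<xi>)"
  shows "free_act M p (free_act N q \<xi>) = free_act N q (free_act M p \<xi>)"
  unfolding free_act_def assms(3)
    linear_on_functions_lin_ext[OF assms(1)] linear_on_functions_lin_ext[OF assms(2)]
  by (subst lin_ext_swap) (rule refl)

lemma (in function_space) free_act_mem:
  assumes "\<And>w. M w \<xi> \<in> V"
  shows "free_act M p \<xi> \<in> V"
proof (induction p rule: poly_mapping_add_induct)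
  case (single w c)
  show ?case using assms scale_mem by (simp add: free_act_def)
next
  case (add p q)
  then show ?case using add_mem by (simp add: free_act_def lin_ext_add)
qed

lemma free_act_add: "free_act M (p + q) \<xi> = (\<lambda>s. free_act M p \<xi> s + free_act M q \<xi> s)"
  by (simp add: free_act_def lin_ext_add)

lemma free_act_diff: "free_act M (p - q) \<xi> = (\<lambda>s. free_act M p \<xi> s - free_act M q \<xi> s)"
  by (simp add: free_act_def lin_ext_diff)

lemma free_act_monomial: "free_act M (monomial c w) \<xi> = (\<lambda>s. c * M w \<xi> s)"
  by (simp add: free_act_def monomial_def)

section \<open>The presented algebra and its actions\<close>

lemma free_ring_simps [simp]:
  "carrier free_ring = UNIV" "p \<otimes>\<^bsub>free_ring\<^esub> q = p * q" "p \<oplus>\<^bsub>free_ring\<^esub> q = p + q"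
  "\<one>\<^bsub>free_ring\<^esub> = 1" "\<zero>\<^bsub>free_ring\<^esub> = 0"
  by (simp_all add: ring_of_type_algebra_def)

lemma ring_free_ring: "ring free_ring"
proof -
  have "\<exists>y. x + y = 0" for x :: free_algebra
    using add.right_inverse by blast
  then show ?thesis
    unfolding ring_of_type_algebra_def using add.right_inverse
    by unfold_locales (auto simp: algebra_simps Units_def)
qed

lemma a_inv_free_ring [simp]: "\<ominus>\<^bsub>free_ring\<^esub> p = - p"
proof -
  interpret ring free_ring by (rule ring_free_ring)
  show ?thesis by (rule minus_equality) simp_all
qed

lemma ideal_relation_ideal: "ideal (relation_ideal h) free_ring"
  unfolding relation_ideal_def by (rule ring.genideal_ideal[OF ring_free_ring]) simp

lemma ring_C_alg: "ring (C_alg h)"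
  unfolding C_alg_def by (rule ideal.quotient_is_ring[OF ideal_relation_ideal])

lemma C_class_hom: "C_class h \<in> ring_hom free_ring (C_alg h)"
  using ideal.rcos_ring_hom[OF ideal_relation_ideal]
  by (simp add: C_alg_def C_class_def[abs_def])

lemma C_class_mult: "C_class h (p * q) = C_class h p \<otimes>\<^bsub>C_alg h\<^esub> C_class h q"
  using ring_hom_mult[OF C_class_hom, of p q] by simp

lemma C_class_add: "C_class h (p + q) = C_class h p \<oplus>\<^bsub>C_alg h\<^esub> C_class h q"
  using ring_hom_add[OF C_class_hom, of p q] by simp

lemma C_class_one: "C_class h 1 = \<one>\<^bsub>C_alg h\<^esub>"
  using ring_hom_one[OF C_class_hom] by simp

lemma carrier_C_alg: "carrier (C_alg h) = range (C_class h)"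
  by (auto simp: C_alg_def FactRing_def A_RCOSETS_def' C_class_def)

lemma C_class_closed [simp]: "C_class h p \<in> carrier (C_alg h)"
  by (simp add: carrier_C_alg)

lemma C_class_eqD:
  assumes "C_class h p = C_class h q" shows "p - q \<in> relation_ideal h"
proof -
  interpret ideal "relation_ideal h" free_ring by (rule ideal_relation_ideal)
  show ?thesis
    using assms ring.quotient_eq_iff_same_a_r_cos[OF ring_free_ring ideal_relation_ideal, of p q]
    by (simp add: C_class_def a_minus_def)
qed

lemma monomial_Nil: "monomial c [] * p = p * monomial c []"
proof (induction p rule: poly_mapping_add_induct)
  case (single w d)
  show ?case by (simp add: monomial_def mult_single plus_list_def mult.commute)
qed (simp add: distrib_left distrib_right)

lemma monomial_one: "monomial 1 [] = 1"
  by (simp add: monomial_def flip: zero_list_def)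

lemma complex_algebra_C_alg: "complex_algebra (C_alg h) (C_scalar h)"
proof -
  interpret ring "C_alg h" by (rule ring_C_alg)
  show ?thesis
  proof
    fix c d
    show "C_scalar h c \<in> carrier (C_alg h)" by (simp add: C_scalar_def)
    show "C_scalar h 1 = \<one>\<^bsub>C_alg h\<^esub>" by (simp add: C_scalar_def monomial_one C_class_one)
    show "C_scalar h (c + d) = C_scalar h c \<oplus>\<^bsub>C_alg h\<^esub> C_scalar h d"
      by (simp add: C_scalar_def monomial_def single_add C_class_add)
    show "C_scalar h (c * d) = C_scalar h c \<otimes>\<^bsub>C_alg h\<^esub> C_scalar h d"
      by (simp add: C_scalar_def monomial_def mult_single plus_list_def flip: C_class_mult)
    fix a assume "a \<in> carrier (C_alg h)"
    then show "C_scalar h c \<otimes>\<^bsub>C_alg h\<^esub> a = a \<otimes>\<^bsub>C_alg h\<^esub> C_scalar h c"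
      by (auto simp: carrier_C_alg C_scalar_def monomial_Nil simp flip: C_class_mult)
  qed
qed


section \<open>Descent to the quotient algebra\<close>

text \<open>The elements acting as zero form a two-sided ideal containing the relators, hence the
  ideal they generate. The disjunction in \<open>comp\<close> lets one proof serve left and right
  actions.\<close>

lemma free_act_relation_ideal:
  assumes lin: "\<And>w. linear_on_functions (M w)"
    and comp: "(\<forall>u v \<xi>. M (u @ v) \<xi> = M u (M v \<xi>)) \<or> (\<forall>u v \<xi>. M (u @ v) \<xi> = M v (M u \<xi>))"
    and rel: "\<And>p \<xi>. p \<in> relators h \<Longrightarrow> free_act M p \<xi> = (\<lambda>s. 0)"
    and p: "p \<in> relation_ideal h"
  shows "free_act M p \<xi> = (\<lambda>s. 0)"
proof -
  \<comment> \<open>Vanishing is required on every \<xi>, because in a product the factor applied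
    last receives the image of \<xi> under the other one. If the factor applied first lies in
    \<open>I\<close>, the last one acts on the zero function, which \<open>zero\<close>
    handles.\<close>
  define I where "I = {p. \<forall>\<xi>. free_act M p \<xi> = (\<lambda>s. 0)}"
  have zero: "free_act M q (\<lambda>s. 0) = (\<lambda>s. 0)" for q
  proof -
    have "\<forall>c \<xi>. free_act M q (\<lambda>s. c * \<xi> s) = (\<lambda>s. c * free_act M q \<xi> s)"
      using linear_free_act[of M q, OF lin] by (simp add: linear_on_functions_def)
    from this[rule_format, of 0 "\<lambda>s. 0"] show ?thesis by simp
  qed
  have mult: "p * q \<in> I" if "p \<in> I \<or> q \<in> I" for p q
    using comp
  proof
    assume "\<forall>u v \<xi>. M (u @ v) \<xi> = M u (M v \<xi>)"
    then show ?thesis using that free_act_mult[of M p q, OF lin] by (auto simp: I_def zero)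
  next
    assume "\<forall>u v \<xi>. M (u @ v) \<xi> = M v (M u \<xi>)"
    then show ?thesis using that free_act_mult_rev[of M p q, OF lin] by (auto simp: I_def zero)
  qed
  have "ideal I free_ring"
  proof (rule idealI[OF ring_free_ring])
    show "subgroup I (add_monoid free_ring)"
    proof (rule group.subgroupI)
      show "group (add_monoid free_ring)"
        by (rule abelian_group.a_group[OF ring.is_abelian_group[OF ring_free_ring]])
      have "0 \<in> I" by (simp add: I_def free_act_def)
      then show "I \<noteq> {}" by blast
      fix p assume p: "p \<in> I"
      have "free_act M (- p) \<xi> = (\<lambda>s. - free_act M p \<xi> s)" for \<xi>
        by (simp add: free_act_def lin_ext_uminus)
      then have "- p \<in> I" using p by (simp add: I_def)
      then show "inv\<^bsub>add_monoid free_ring\<^esub> p \<in> I"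
        using a_inv_free_ring[of p] by (simp add: a_inv_def)
      fix q assume "q \<in> I"
      with p show "p \<otimes>\<^bsub>add_monoid free_ring\<^esub> q \<in> I" by (simp add: I_def free_act_add)
    qed simp
  qed (simp_all add: mult)
  moreover have "relators h \<subseteq> I" using rel by (auto simp: I_def)
  ultimately have "relation_ideal h \<subseteq> I"
    unfolding relation_ideal_def by (rule ring.genideal_minimal[OF ring_free_ring])
  with p show ?thesis by (auto simp: I_def)
qed

text \<open>Choosing a representative gives a total function without a prior proof of
  well-definedness; independence of the choice is \<open>quot_act_class\<close>.\<close>

definition quot_act ::
  "real \<Rightarrow> (gen list \<Rightarrow> ('s \<Rightarrow> complex) \<Rightarrow> 's \<Rightarrow> complex) \<Rightarrow>
    free_algebra set \<Rightarrow> ('s \<Rightarrow> complex) \<Rightarrow> 's \<Rightarrow> complex"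
  where "quot_act h M a = free_act M (SOME p. C_class h p = a)"

text \<open>The chosen representative differs from \<open>p\<close> by an element of the relation
  ideal, which acts as zero.\<close>

lemma quot_act_class:
  assumes "\<And>w. linear_on_functions (M w)"
    and "(\<forall>u v \<xi>. M (u @ v) \<xi> = M u (M v \<xi>)) \<or> (\<forall>u v \<xi>. M (u @ v) \<xi> = M v (M u \<xi>))"
    and "\<And>p \<xi>. p \<in> relators h \<Longrightarrow> free_act M p \<xi> = (\<lambda>s. 0)"
  shows "quot_act h M (C_class h p) \<xi> = free_act M p \<xi>"
proof -
  define q where "q = (SOME q. C_class h q = C_class h p)"
  have "C_class h q = C_class h p"
    unfolding q_def by (rule someI) (rule refl)
  then have "free_act M (q - p) \<xi> = (\<lambda>s. 0)"
    using free_act_relation_ideal[of M, OF assms] C_class_eqD by blast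
  then show ?thesis
    by (simp add: quot_act_def free_act_diff fun_eq_iff flip: q_def)
qed

lemma left_module_quot_act:
  fixes M :: "gen list \<Rightarrow> ('s \<Rightarrow> complex) \<Rightarrow> 's \<Rightarrow> complex"
  assumes V: "function_space V"
    and mem: "\<And>w \<xi>. \<xi> \<in> V \<Longrightarrow> M w \<xi> \<in> V"
    and lin: "\<And>w. linear_on_functions (M w)"
    and Nil: "\<And>\<xi>. M [] \<xi> = \<xi>"
    and comp: "\<And>u v \<xi>. M (u @ v) \<xi> = M u (M v \<xi>)"
    and rel: "\<And>p \<xi>. p \<in> relators h \<Longrightarrow> free_act M p \<xi> = (\<lambda>s. 0)"
  shows "left_algebra_module (C_alg h) (C_scalar h) V (quot_act h M)"
proof -
  have act: "quot_act h M (C_class h p) \<xi> = free_act M p \<xi>" for p \<xi>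
    using lin comp rel by (intro quot_act_class) auto
  show ?thesis
  proof (rule left_algebra_module.intro[OF complex_algebra_C_alg V], unfold_locales, goal_cases)
    case 1 then show ?case
      using function_space.free_act_mem[OF V, of M] mem by (auto simp: carrier_C_alg act)
  next
    case 2 then show ?case
      using linear_free_act[of M, OF lin] by (auto simp: carrier_C_alg act linear_on_functions_def)
  next
    case 3 then show ?case by (auto simp: carrier_C_alg act free_act_add simp flip: C_class_add)
  next
    case 4 then show ?case
      by (auto simp: carrier_C_alg act free_act_mult[of M, OF lin comp] simp flip: C_class_mult)
  next
    case 5 then show ?case by (simp add: C_scalar_def act free_act_monomial Nil)
  qed
qed

lemma right_module_quot_act:
  fixes M :: "gen list \<Rightarrow> ('s \<Rightarrow> complex) \<Rightarrow> 's \<Rightarrow> complex"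
  assumes V: "function_space V"
    and mem: "\<And>w \<xi>. \<xi> \<in> V \<Longrightarrow> M w \<xi> \<in> V"
    and lin: "\<And>w. linear_on_functions (M w)"
    and Nil: "\<And>\<xi>. M [] \<xi> = \<xi>"
    and comp: "\<And>u v \<xi>. M (u @ v) \<xi> = M v (M u \<xi>)"
    and rel: "\<And>p \<xi>. p \<in> relators h \<Longrightarrow> free_act M p \<xi> = (\<lambda>s. 0)"
  shows "right_algebra_module (C_alg h) (C_scalar h) V (\<lambda>\<xi> a. quot_act h M a \<xi>)"
proof -
  have act: "quot_act h M (C_class h p) \<xi> = free_act M p \<xi>" for p \<xi>
    using lin comp rel by (intro quot_act_class) auto
  show ?thesis
  proof (rule right_algebra_module.intro[OF complex_algebra_C_alg V], unfold_locales, goal_cases)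
    case 1 then show ?case
      using function_space.free_act_mem[OF V, of M] mem by (auto simp: carrier_C_alg act)
  next
    case 2 then show ?case
      using linear_free_act[of M, OF lin] by (auto simp: carrier_C_alg act linear_on_functions_def)
  next
    case 3 then show ?case by (auto simp: carrier_C_alg act free_act_add simp flip: C_class_add)
  next
    case 4 then show ?case
      by (auto simp: carrier_C_alg act free_act_mult_rev[of M, OF lin comp] simp flip: C_class_mult)
  next
    case 5 then show ?case by (simp add: C_scalar_def act free_act_monomial Nil)
  qed
qed

section \<open>Actions are determined by the generators\<close>

lemma C_class_monomial: "C_class h (monomial c w) = C_scalar h c \<otimes>\<^bsub>C_alg h\<^esub> C_class h (monomial 1 w)"
  by (simp add: C_scalar_def monomial_def mult_single plus_list_def flip: C_class_mult)

lemma C_class_monomial_append: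
  "C_class h (monomial 1 (u @ v)) = C_class h (monomial 1 u) \<otimes>\<^bsub>C_alg h\<^esub> C_class h (monomial 1 v)"
  by (simp add: monomial_def mult_single plus_list_def flip: C_class_mult)

lemma C_scalar_closed: "C_scalar h c \<in> carrier (C_alg h)"
  by (simp add: C_scalar_def)

text \<open>Multiplicativity fixes the action of words, and additivity together with the scalar
  axiom fixes the rest. Every class has the form \<open>C_class h p\<close>, so this determines the
  action on the whole carrier.\<close>

lemma left_action_unique:
  assumes "left_algebra_module (C_alg h) (C_scalar h) V lact"
    and gens: "\<And>g \<xi>. \<xi> \<in> V \<Longrightarrow> lact (C_gen h g) \<xi> = T g \<xi>"
    and \<xi>: "\<xi> \<in> V"
  shows "lact (C_class h p) \<xi> = free_act (foldr T) p \<xi>"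
proof -
  interpret left_algebra_module "C_alg h" "C_scalar h" V lact by fact
  \<comment> \<open>Membership in \<open>V\<close> is carried along because \<open>gens\<close>
    speaks only about elements of \<open>V\<close>. The empty word is the scalar 1.\<close>
  have word: "lact (C_class h (monomial 1 w)) \<xi> = foldr T w \<xi> \<and> foldr T w \<xi> \<in> V" for w
  proof (induction w)
    case Nil
    show ?case using \<xi> lact_scalar[of \<xi> 1] by (simp add: C_scalar_def)
  next
    case (Cons g w)
    have "C_gen h g \<in> carrier (C_alg h)" by (simp add: C_gen_def)
    then have "lact (C_class h (monomial 1 (g # w))) \<xi> = lact (C_gen h g) (foldr T w \<xi>)"
      using C_class_monomial_append[of h "[g]" w] Cons \<xi> by (simp add: C_gen_def lact_mult)
    moreover have "lact (C_gen h g) (foldr T w \<xi>) \<in> V"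
      using lact_closed Cons by (simp add: C_gen_def)
    ultimately show ?case using Cons gens by simp
  qed
  show ?thesis
  proof (induction p rule: poly_mapping_add_induct)
    case (single w c)
    show ?case
      using word[of w] \<xi> C_class_monomial[of h c w]
      by (simp add: lact_mult C_scalar_closed lact_scalar lact_closed free_act_def
          flip: monomial_def)
        (simp add: monomial_def)
  next
    case (add p q)
    then show ?case using \<xi> by (simp add: C_class_add lact_add_left free_act_add)
  qed
qed

text \<open>On the right the last letter of a word acts last, so the induction on words appends
  generators at the end, which matches \<open>fold\<close>.\<close>

lemma right_action_unique:
  assumes "right_algebra_module (C_alg h) (C_scalar h) V ract"
    and gens: "\<And>g \<xi>. \<xi> \<in> V \<Longrightarrow> ract \<xi> (C_gen h g) = T g \<xi>"
    and \<xi>: "\<xi> \<in> V"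
  shows "ract \<xi> (C_class h p) = free_act (fold T) p \<xi>"
proof -
  interpret right_algebra_module "C_alg h" "C_scalar h" V ract by fact
  have word: "ract \<xi> (C_class h (monomial 1 w)) = fold T w \<xi> \<and> fold T w \<xi> \<in> V" for w
  proof (induction w rule: rev_induct)
    case Nil
    show ?case using \<xi> ract_scalar[of \<xi> 1] by (simp add: C_scalar_def)
  next
    case (snoc g w)
    have "C_gen h g \<in> carrier (C_alg h)" by (simp add: C_gen_def)
    then have "ract \<xi> (C_class h (monomial 1 (w @ [g]))) = ract (fold T w \<xi>) (C_gen h g)"
      using C_class_monomial_append[of h w "[g]"] snoc \<xi> by (simp add: C_gen_def ract_mult)
    moreover have "ract (fold T w \<xi>) (C_gen h g) \<in> V"
      using ract_closed snoc by (simp add: C_gen_def)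
    ultimately show ?case using snoc gens by simp
  qed
  show ?thesis
  proof (induction p rule: poly_mapping_add_induct)
    case (single w c)
    \<comment> \<open>Centrality moves the scalar to the right, so that it acts after the word and
      \<open>ract_scalar\<close> applies to the result.\<close>
    have comm: "C_class h (monomial c w) = C_class h (monomial 1 w) \<otimes>\<^bsub>C_alg h\<^esub> C_scalar h c"
      using C_class_monomial[of h c w] scalar_central by simp
    show ?case
      using word[of w] \<xi> comm
      by (simp add: ract_mult C_scalar_closed ract_scalar ract_closed free_act_def
          flip: monomial_def)
        (simp add: monomial_def)
  next
    case (add p q)
    then show ?case using \<xi> by (simp add: C_class_add ract_add_right free_act_add)
  qed
qed

section \<open>Smooth functions and test functions\<close>

text \<open>All iterated derivatives stay in the class \<open>P\<close>, so no formula for the n-th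
  derivative has to be found.\<close>

lemma smooth_coinduct:
  assumes "P f"
    and "\<And>f t. P f \<Longrightarrow> f differentiable (at t)"
    and "\<And>f. P f \<Longrightarrow> P (\<lambda>t. vector_derivative f (at t))"
  shows "smooth f"
proof -
  have "P (((\<lambda>g s. vector_derivative g (at s)) ^^ n) f)" for n
    by (induction n) (simp_all add: assms)
  then show ?thesis by (auto simp: smooth_def intro: assms)
qed

lemma smooth_differentiable: "smooth f \<Longrightarrow> f differentiable (at t)"
  unfolding smooth_def by (metis funpow_0)

lemma smooth_vector_derivative: "smooth f \<Longrightarrow> smooth (\<lambda>t. vector_derivative f (at t))"
proof -
  let ?D = "\<lambda>g (s :: real). vector_derivative g (at s)"
  assume "smooth f"
  then have "(?D ^^ Suc n) f differentiable (at t)" for n t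
    unfolding smooth_def by blast
  \<comment> \<open>The n-th derivative of f' is the derivative of order n + 1 of f, with the extra
    differentiation applied first.\<close>
  then show ?thesis by (simp only: smooth_def funpow_Suc_right comp_apply) blast
qed

lemma smooth_has_vector_derivative:
  "smooth f \<Longrightarrow> (f has_vector_derivative vector_derivative f (at t)) (at t)"
  using smooth_differentiable vector_derivative_works by blast

text \<open>Here a derivative is only exhibited; uniqueness of derivatives identifies it with
  \<open>vector_derivative\<close>.\<close>

lemma smooth_coinduct_deriv:
  assumes "P f"
    and "\<And>f. P f \<Longrightarrow> \<exists>f'. P f' \<and> (\<forall>t. (f has_vector_derivative f' t) (at t))"
  shows "smooth f"
proof (rule smooth_coinduct[of P, OF assms(1)])
  show "g differentiable (at t)" if "P g" for g t
    using assms(2)[OF that] differentiableI_vector by blast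
  show "P (\<lambda>t. vector_derivative g (at t))" if "P g" for g
  proof -
    obtain g' where g': "P g'" "\<And>t. (g has_vector_derivative g' t) (at t)"
      using assms(2)[OF \<open>P g\<close>] by blast
    then have "(\<lambda>t. vector_derivative g (at t)) = g'"
      by (auto simp: vector_derivative_at)
    with g' show ?thesis by simp
  qed
qed

text \<open>Affine functions are closed under differentiation. Slope 0 gives the constants; the
  general case is needed for the multiplier of \<open>U\<close>.\<close>

lemma smooth_affine: "smooth (\<lambda>t. c * of_real t + d)"
proof (rule smooth_coinduct_deriv[of "\<lambda>f. \<exists>c d. f = (\<lambda>t. c * of_real t + d)"])
  fix f :: "real \<Rightarrow> complex"
  assume "\<exists>c d. f = (\<lambda>t. c * of_real t + d)"
  then obtain c d where f: "f = (\<lambda>t. c * of_real t + d)" by blast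
  have "(f has_vector_derivative 0 * of_real t + c) (at t)" for t
    unfolding f by (auto intro!: derivative_eq_intros has_vector_derivative_real_field)
  then show "\<exists>f'. (\<exists>c d. f' = (\<lambda>t. c * of_real t + d)) \<and> (\<forall>t. (f has_vector_derivative f' t) (at t))"
    by blast
qed blast

text \<open>The class closed under differentiation consists of the constant multiples of this
  exponential: each derivative multiplies the constant by \<open>a\<close>.\<close>

lemma smooth_exp: "smooth (\<lambda>t. of_real (exp (a * t + b)))"
proof (rule smooth_coinduct_deriv[of "\<lambda>f. \<exists>c. f = (\<lambda>t. c * of_real (exp (a * t + b)))"])
  fix f :: "real \<Rightarrow> complex"
  assume "\<exists>c. f = (\<lambda>t. c * of_real (exp (a * t + b)))"
  then obtain c where f: "f = (\<lambda>t. c * of_real (exp (a * t + b)))" by blast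
  have "((\<lambda>t. exp (a * t + b)) has_real_derivative exp (a * t + b) * a) (at t)" for t
    by (auto intro!: derivative_eq_intros)
  then have "(f has_vector_derivative c * of_real (exp (a * t + b) * a)) (at t)" for t
    unfolding f by (intro has_vector_derivative_mult_right has_vector_derivative_of_real)
  then have "(f has_vector_derivative (c * of_real a) * of_real (exp (a * t + b))) (at t)" for t
    by (simp add: mult.assoc mult.commute[of "of_real (exp _)"])
  then show "\<exists>f'. (\<exists>c. f' = (\<lambda>t. c * of_real (exp (a * t + b)))) \<and> (\<forall>t. (f has_vector_derivative f' t) (at t))"
    by blast
qed (rule exI[of _ 1], simp)

lemma smooth_add:
  assumes "smooth f" "smooth g"
  shows "smooth (\<lambda>t. f t + g t)"
proof (rule smooth_coinduct_deriv[of "\<lambda>h. \<exists>f g. smooth f \<and> smooth g \<and> h = (\<lambda>t. f t + g t)"])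
  fix h :: "real \<Rightarrow> complex"
  assume "\<exists>f g. smooth f \<and> smooth g \<and> h = (\<lambda>t. f t + g t)"
  then obtain f g where "smooth f" "smooth g" "h = (\<lambda>t. f t + g t)" by blast
  then show "\<exists>h'. (\<exists>f g. smooth f \<and> smooth g \<and> h' = (\<lambda>t. f t + g t)) \<and>
      (\<forall>t. (h has_vector_derivative h' t) (at t))"
    by (intro exI[of _ "\<lambda>t. vector_derivative f (at t) + vector_derivative g (at t)"])
      (auto intro!: has_vector_derivative_add smooth_has_vector_derivative smooth_vector_derivative)
qed (use assms in blast)

lemma smooth_shift:
  assumes "smooth f"
  shows "smooth (\<lambda>t. f (t + c))"
proof (rule smooth_coinduct_deriv[of "\<lambda>h. \<exists>f. smooth f \<and> h = (\<lambda>t. f (t + c))"])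
  fix h :: "real \<Rightarrow> complex"
  assume "\<exists>f. smooth f \<and> h = (\<lambda>t. f (t + c))"
  then obtain f where f: "smooth f" "h = (\<lambda>t. f (t + c))" by blast
  have "((\<lambda>t. f (t + c)) has_vector_derivative 1 *\<^sub>R vector_derivative f (at (t + c))) (at t)" for t
  proof -
    have "((\<lambda>t. t + c) has_vector_derivative 1) (at t)"
      by (auto intro!: derivative_eq_intros)
    from vector_diff_chain_at[OF this smooth_has_vector_derivative[OF f(1)]]
    show ?thesis by (simp add: o_def)
  qed
  with f show "\<exists>h'. (\<exists>f. smooth f \<and> h' = (\<lambda>t. f (t + c))) \<and>
      (\<forall>t. (h has_vector_derivative h' t) (at t))"
    by (intro exI[of _ "\<lambda>t. vector_derivative f (at (t + c))"])
      (auto intro!: smooth_vector_derivative exI[of _ "\<lambda>t. vector_derivative f (at t)"])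
qed (use assms in blast)

text \<open>Sums of products of smooth functions are closed under differentiation by the product rule,
  so coinduction needs no Leibniz formula for higher derivatives.\<close>

inductive sum_of_products :: "(real \<Rightarrow> complex) \<Rightarrow> bool" where
  product: "smooth f \<Longrightarrow> smooth g \<Longrightarrow> sum_of_products (\<lambda>t. f t * g t)"
| sum: "sum_of_products f \<Longrightarrow> sum_of_products g \<Longrightarrow> sum_of_products (\<lambda>t. f t + g t)"

lemma sum_of_products_deriv:
  "sum_of_products f \<Longrightarrow>
    \<exists>f'. sum_of_products f' \<and> (\<forall>t. (f has_vector_derivative f' t) (at t))"
proof (induction rule: sum_of_products.induct)
  case (product f g)
  then show ?case
    by (intro exI[of _ "\<lambda>t. f t * vector_derivative g (at t) + vector_derivative f (at t) * g t"]
        conjI allI sum_of_products.intros has_vector_derivative_mult smooth_has_vector_derivative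
        smooth_vector_derivative)
next
  case (sum f g)
  then obtain f' g' where
    "sum_of_products f'" "\<And>t. (f has_vector_derivative f' t) (at t)"
    "sum_of_products g'" "\<And>t. (g has_vector_derivative g' t) (at t)"
    by blast
  then show ?case
    by (intro exI[of _ "\<lambda>t. f' t + g' t"] conjI allI sum_of_products.sum has_vector_derivative_add)
qed

lemma smooth_mult: "smooth f \<Longrightarrow> smooth g \<Longrightarrow> smooth (\<lambda>t. f t * g t)"
  using smooth_coinduct_deriv[of sum_of_products] sum_of_products_deriv sum_of_products.product
  by blast

section \<open>Compact support and closure properties of test functions\<close>

lemma compact_closure_subset:
  fixes S :: "'a::t2_space set"
  assumes "compact K" "S \<subseteq> K"
  shows "compact (closure S)"
proof -
  have "closure S \<subseteq> K"
    using assms by (intro closure_minimal compact_imp_closed)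
  then show ?thesis
    using compact_Int_closed[OF assms(1) closed_closure[of S]] by (simp add: Int_absorb1)
qed

text \<open>Any compact set containing the points where \<xi> is nonzero will do, so closures of
  supports need not be computed.\<close>

lemma test_functionsI:
  assumes "\<And>k. smooth (\<lambda>x. \<xi> (x, k))" "compact K" "\<And>p. \<xi> p \<noteq> 0 \<Longrightarrow> p \<in> K"
  shows "\<xi> \<in> test_functions"
proof -
  have "compact (closure {p. \<xi> p \<noteq> 0})"
    using assms(2,3) by (intro compact_closure_subset[of K]) (simp_all add: subset_iff)
  with assms(1) show ?thesis by (simp add: test_functions_def)
qed

lemma test_functions_smooth: "\<xi> \<in> test_functions \<Longrightarrow> smooth (\<lambda>x. \<xi> (x, k))"
  by (simp add: test_functions_def)

lemma test_functions_support:
  assumes "\<xi> \<in> test_functions"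
  obtains K where "compact K" "\<And>p. \<xi> p \<noteq> 0 \<Longrightarrow> p \<in> K"
proof
  show "compact (closure {p. \<xi> p \<noteq> 0})" using assms by (simp add: test_functions_def)
  show "p \<in> closure {p. \<xi> p \<noteq> 0}" if "\<xi> p \<noteq> 0" for p
    using that closure_subset[of "{p. \<xi> p \<noteq> 0}"] by blast
qed

lemma test_functions_mult:
  assumes "\<And>k. smooth (\<lambda>x. m (x, k))" "\<xi> \<in> test_functions"
  shows "(\<lambda>p. m p * \<xi> p) \<in> test_functions"
proof -
  obtain K where "compact K" "\<And>p. \<xi> p \<noteq> 0 \<Longrightarrow> p \<in> K"
    using test_functions_support assms(2) by blast
  then show ?thesis
    using assms by (intro test_functionsI[of _ K]) (auto intro: smooth_mult test_functions_smooth)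
qed

lemma test_functions_shift:
  assumes "\<xi> \<in> test_functions"
  shows "(\<lambda>(x, k). \<xi> (x + c, k + d)) \<in> test_functions"
proof -
  obtain K where K: "compact K" "\<And>p. \<xi> p \<noteq> 0 \<Longrightarrow> p \<in> K"
    using test_functions_support assms by blast
  \<comment> \<open>The translated function is nonzero only on the image of \<open>K\<close> under
    the opposite translation.\<close>
  let ?\<tau> = "\<lambda>p :: real \<times> int. (fst p + - c, snd p + - d)"
  have "continuous_on K ?\<tau>" by (intro continuous_intros)
  then have "compact (?\<tau> ` K)" using K by (intro compact_continuous_image)
  moreover have "(x, k) \<in> ?\<tau> ` K" if "\<xi> (x + c, k + d) \<noteq> 0" for x k
    using K(2)[OF that] by (force simp: image_iff)
  ultimately show ?thesis
    using assms by (intro test_functionsI) (auto intro: smooth_shift test_functions_smooth)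
qed

lemma function_space_test_functions: "function_space test_functions"
proof
  show "(\<lambda>p. 0) \<in> test_functions"
    using smooth_affine[of 0 0] by (intro test_functionsI[of _ "{}"]) auto
  \<comment> \<open>Scaling is multiplication by a constant function, which is smooth.\<close>
  show "(\<lambda>p. c * \<xi> p) \<in> test_functions" if "\<xi> \<in> test_functions" for c \<xi>
    using that smooth_affine[of 0 c] by (intro test_functions_mult) auto
  fix \<xi> \<zeta> :: "real \<times> int \<Rightarrow> complex"
  assume \<xi>: "\<xi> \<in> test_functions" and \<zeta>: "\<zeta> \<in> test_functions"
  obtain K where K: "compact K" "\<And>p. \<xi> p \<noteq> 0 \<Longrightarrow> p \<in> K"
    using test_functions_support \<xi> by blast
  obtain L where L: "compact L" "\<And>p. \<zeta> p \<noteq> 0 \<Longrightarrow> p \<in> L"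
    using test_functions_support \<zeta> by blast
  show "(\<lambda>p. \<xi> p + \<zeta> p) \<in> test_functions"
  proof (rule test_functionsI)
    show "smooth (\<lambda>x. \<xi> (x, k) + \<zeta> (x, k))" for k
      using \<xi> \<zeta> by (intro smooth_add test_functions_smooth)
    show "compact (K \<union> L)" using K L by (intro compact_Un)
    show "p \<in> K \<union> L" if "\<xi> p + \<zeta> p \<noteq> 0" for p
      using that K(2)[of p] L(2)[of p] by fastforce
  qed
qed

section \<open>The prescribed operators\<close>

definition phase :: "real \<Rightarrow> real \<Rightarrow> real \<times> int \<Rightarrow> real" where
  "phase a b p = a * fst p + b * of_int (snd p)"

text \<open>\<open>Rinv\<close> and \<open>Winv\<close> are written out explicitly, although the
  requirements describe them only as inverses. The same operators serve both actions; only the order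
  of composition, \<open>foldr\<close> or \<open>fold\<close>, differs.\<close>

fun gen_op ::
  "real \<Rightarrow> int \<Rightarrow> real \<Rightarrow> real \<Rightarrow> gen \<Rightarrow> (real \<times> int \<Rightarrow> complex) \<Rightarrow> real \<times> int \<Rightarrow> complex"
where
  "gen_op \<epsilon> r a b U \<xi> = (\<lambda>p. of_real (phase a b p) * \<xi> p)"
| "gen_op \<epsilon> r a b R \<xi> = (\<lambda>p. of_real (exp (phase a b p)) * \<xi> p)"
| "gen_op \<epsilon> r a b Rinv \<xi> = (\<lambda>p. of_real (exp (- phase a b p)) * \<xi> p)"
| "gen_op \<epsilon> r a b W \<xi> = (\<lambda>(x, k). \<xi> (x - \<epsilon>, k - r))"
| "gen_op \<epsilon> r a b Winv \<xi> = (\<lambda>(x, k). \<xi> (x + \<epsilon>, k + r))"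

text \<open>The phase is linear, so a translation changes it by a constant; this constant produces
  every power of e and every additive term in the relations.\<close>

lemma phase_shift:
  "phase a b (x + \<epsilon>, k + r) = phase a b (x, k) + (a * \<epsilon> + b * of_int r)"
  "phase a b (x - \<epsilon>, k - r) = phase a b (x, k) - (a * \<epsilon> + b * of_int r)"
  by (simp_all add: phase_def algebra_simps)

lemma phase_pair: "phase a b (x, k) = a * x + b * of_int k"
  by (simp add: phase_def)

lemma exp_minus_mult_of_real [simp]:
  "complex_of_real (exp (- t)) * (of_real (exp t) * z) = z"
  "complex_of_real (exp t) * (of_real (exp (- t)) * z) = z"
  by (simp_all add: exp_minus)

lemma linear_gen_op: "linear_on_functions (gen_op \<epsilon> r a b g)"
  by (cases g) (auto simp: linear_on_functions_def fun_eq_iff algebra_simps)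

lemma linear_foldr: "(\<And>g. linear_on_functions (T g)) \<Longrightarrow> linear_on_functions (foldr T w)"
  by (induction w) (auto simp: linear_on_functions_def)

lemma linear_fold: "(\<And>g. linear_on_functions (T g)) \<Longrightarrow> linear_on_functions (fold T w)"
  by (induction w) (auto simp: linear_on_functions_def)

lemma gen_op_mem:
  assumes "\<xi> \<in> test_functions"
  shows "gen_op \<epsilon> r a b g \<xi> \<in> test_functions"
proof (cases g)
  case U
  have "smooth (\<lambda>x. complex_of_real (phase a b (x, k)))" for k
    using smooth_affine[of "of_real a" "of_real (b * of_int k)"] by (simp add: phase_def)
  with U assms show ?thesis by (simp add: test_functions_mult)
next
  case R
  have "smooth (\<lambda>x. complex_of_real (exp (phase a b (x, k))))" for k
    using smooth_exp[of a "b * of_int k"] by (simp add: phase_def)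
  with R assms show ?thesis by (simp add: test_functions_mult)
next
  case Rinv
  have "smooth (\<lambda>x. complex_of_real (exp (- phase a b (x, k))))" for k
    using smooth_exp[of "- a" "- b * of_int k"] by (simp add: phase_def)
  with Rinv assms show ?thesis by (simp add: test_functions_mult)
next
  case W
  then show ?thesis using test_functions_shift[OF assms, of "- \<epsilon>" "- r"] by simp
next
  case Winv
  then show ?thesis using test_functions_shift[OF assms, of \<epsilon> r] by simp
qed

lemma foldr_gen_op_mem: "\<xi> \<in> test_functions \<Longrightarrow> foldr (gen_op \<epsilon> r a b) w \<xi> \<in> test_functions"
  by (induction w) (auto intro: gen_op_mem)

lemma fold_gen_op_mem: "\<xi> \<in> test_functions \<Longrightarrow> fold (gen_op \<epsilon> r a b) w \<xi> \<in> test_functions"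
  by (induction w arbitrary: \<xi>) (auto intro: gen_op_mem)

lemma prescribed_gen_op: "prescribed_operators \<epsilon> r a b (gen_op \<epsilon> r a b)"
  by (auto simp: prescribed_operators_def fun_eq_iff simp flip: phase_pair)

lemma prescribed_operators_unique:
  assumes T: "prescribed_operators \<epsilon> r a b T" and \<xi>: "\<xi> \<in> test_functions"
  shows "T g \<xi> = gen_op \<epsilon> r a b g \<xi>"
proof -
  have W: "T W \<zeta> = gen_op \<epsilon> r a b W \<zeta>" and R: "T R \<zeta> = gen_op \<epsilon> r a b R \<zeta>"
    and U: "T U \<zeta> = gen_op \<epsilon> r a b U \<zeta>"
    and inv: "T Winv (T W \<zeta>) = \<zeta>" "T Rinv (T R \<zeta>) = \<zeta>" if "\<zeta> \<in> test_functions" for \<zeta>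
    using T that by (auto simp: prescribed_operators_def fun_eq_iff simp flip: phase_pair)
  \<comment> \<open>Explicit preimages of \<xi> under \<open>T W\<close> and \<open>T R\<close>.
    Applying \<open>T Winv\<close> and \<open>T Rinv\<close> to these equations forces their values
    at \<xi>.\<close>
  have "T W (gen_op \<epsilon> r a b Winv \<xi>) = \<xi>" "T R (gen_op \<epsilon> r a b Rinv \<xi>) = \<xi>"
    unfolding W[OF gen_op_mem[OF \<xi>]] R[OF gen_op_mem[OF \<xi>]] by (simp_all add: fun_eq_iff)
  with inv gen_op_mem[OF \<xi>] have "T Winv \<xi> = gen_op \<epsilon> r a b Winv \<xi>" "T Rinv \<xi> = gen_op \<epsilon> r a b Rinv \<xi>"
    by metis+
  with W R U \<xi> show ?thesis by (cases g) auto
qed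

section \<open>Relators and existence of the two actions\<close>

lemma free_act_one: "M [] \<xi> = \<xi> \<Longrightarrow> free_act M 1 \<xi> = \<xi>"
  using free_act_monomial[of M 1 "[]" \<xi>] by (simp add: monomial_one)

text \<open>The word \<open>[W, R]\<close> applies \<open>R\<close> first, so its exponential is
  evaluated at the translated point, where the phase is larger by \<open>h\<close>; this is the
  factor in WR = e^h RW. The relations with \<open>U\<close> arise in the same way.\<close>

lemma left_relators:
  assumes d: "a * \<epsilon> + b * of_int r = - h" and p: "p \<in> relators h"
  shows "free_act (foldr (gen_op \<epsilon> r a b)) p \<xi> = (\<lambda>s. 0)"
proof -
  have shift: "phase a b (x + \<epsilon>, k + r) = phase a b (x, k) - h" "phase a b (x - \<epsilon>, k - r) = phase a b (x, k) + h"
    for x k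
    by (simp_all add: phase_shift d)
  show ?thesis
    using p unfolding relators_def
    by (elim insertE emptyE; hypsubst)
      (simp_all add: shift free_act_diff free_act_add free_act_monomial free_act_one fun_eq_iff
        exp_add exp_diff exp_minus field_simps)
qed

text \<open>Now \<open>[W, R]\<close> applies \<open>W\<close> first, and it is
  \<open>[R, W]\<close> whose exponential is evaluated at the translated point. The reversal is
  compensated by the opposite sign in \<open>d\<close>.\<close>

lemma right_relators:
  assumes d: "a * \<epsilon> + b * of_int r = h" and p: "p \<in> relators h"
  shows "free_act (fold (gen_op \<epsilon> r a b)) p \<xi> = (\<lambda>s. 0)"
proof -
  have shift: "phase a b (x + \<epsilon>, k + r) = phase a b (x, k) + h" "phase a b (x - \<epsilon>, k - r) = phase a b (x, k) - h"
    for x k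
    by (simp_all add: phase_shift d)
  show ?thesis
    using p unfolding relators_def
    by (elim insertE emptyE; hypsubst)
      (simp_all add: shift free_act_diff free_act_add free_act_monomial free_act_one fun_eq_iff
        exp_add exp_diff exp_minus field_simps)
qed

lemma prescribed_operators_cong:
  assumes "prescribed_operators \<epsilon> r a b T"
    and "\<And>g \<xi>. S g \<xi> = T g \<xi>"
  shows "prescribed_operators \<epsilon> r a b S"
  using assms by (simp add: prescribed_operators_def)

lemma left_action_exists:
  assumes "a * \<epsilon> + b * of_int r = - h"
  shows "is_left_action h \<epsilon> r a b (quot_act h (foldr (gen_op \<epsilon> r a b)))"
proof -
  let ?M = "foldr (gen_op \<epsilon> r a b)"
  have lin: "linear_on_functions (?M w)" for w
    by (intro linear_foldr linear_gen_op)
  have "left_algebra_module (C_alg h) (C_scalar h) test_functions (quot_act h ?M)"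
    by (rule left_module_quot_act)
      (simp_all add: function_space_test_functions foldr_gen_op_mem lin left_relators[OF assms])
  moreover have "quot_act h ?M (C_gen h g) \<xi> = gen_op \<epsilon> r a b g \<xi>" for g \<xi>
    unfolding C_gen_def
    by (subst quot_act_class) (simp_all add: lin left_relators[OF assms] free_act_monomial)
  ultimately show ?thesis
    unfolding is_left_action_def by (auto intro: prescribed_operators_cong[OF prescribed_gen_op])
qed

lemma right_action_exists:
  assumes "a * \<epsilon> + b * of_int r = h"
  shows "is_right_action h \<epsilon> r a b (\<lambda>\<xi> c. quot_act h (fold (gen_op \<epsilon> r a b)) c \<xi>)"
proof -
  let ?M = "fold (gen_op \<epsilon> r a b)"
  have lin: "linear_on_functions (?M w)" for w
    by (intro linear_fold linear_gen_op)
  have "right_algebra_module (C_alg h) (C_scalar h) test_functions (\<lambda>\<xi> c. quot_act h ?M c \<xi>)"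
    by (rule right_module_quot_act)
      (simp_all add: function_space_test_functions fold_gen_op_mem lin right_relators[OF assms])
  moreover have "quot_act h ?M (C_gen h g) \<xi> = gen_op \<epsilon> r a b g \<xi>" for g \<xi>
    unfolding C_gen_def
    by (subst quot_act_class) (simp_all add: lin right_relators[OF assms] free_act_monomial)
  ultimately show ?thesis
    unfolding is_right_action_def by (auto intro: prescribed_operators_cong[OF prescribed_gen_op])
qed

section \<open>Commutation of the two actions and the bimodule property\<close>

text \<open>Two multiplication operators commute, and so do two translations. In the mixed cases the
  hypotheses make the phase in the multiplier invariant under the translation.\<close>

lemma gen_op_commute:
  assumes "a * \<epsilon>' + b * of_int r' = 0" "a' * \<epsilon> + b' * of_int r = 0"
  shows "gen_op \<epsilon> r a b g (gen_op \<epsilon>' r' a' b' g' \<xi>) = gen_op \<epsilon>' r' a' b' g' (gen_op \<epsilon> r a b g \<xi>)"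
proof -
  have "phase a b (x + \<epsilon>', k + r') = phase a b (x, k)" "phase a b (x - \<epsilon>', k - r') = phase a b (x, k)"
    "phase a' b' (x + \<epsilon>, k + r) = phase a' b' (x, k)" "phase a' b' (x - \<epsilon>, k - r) = phase a' b' (x, k)"
    for x k
    by (simp_all add: phase_shift assms)
  then show ?thesis
    by (cases g; cases g') (simp_all add: fun_eq_iff algebra_simps)
qed

text \<open>A single \<open>S g\<close> is first moved past the whole word \<open>v\<close>; then
  the letters of \<open>u\<close> are moved one at a time.\<close>

lemma foldr_fold_commute:
  assumes "\<And>g g' \<xi>. S g (T g' \<xi>) = T g' (S g \<xi>)"
  shows "foldr S u (fold T v \<xi>) = fold T v (foldr S u \<xi>)"
proof -
  have "S g (fold T v \<xi>) = fold T v (S g \<xi>)" for g \<xi>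
    by (induction v arbitrary: \<xi>) (simp_all add: assms)
  then show ?thesis by (induction u) simp_all
qed

theorem proposition5p2:
  fixes h h' :: real
    and lam0 lam1 mu0 mu1 \<epsilon> \<epsilon>' :: real
    and r r' :: int
  assumes "lam0 * \<epsilon> + lam1 * of_int r = - h"
    and "mu0 * \<epsilon>' + mu1 * of_int r' = h'"
    and "lam0 * \<epsilon>' + lam1 * of_int r' = 0"
    and "mu0 * \<epsilon> + mu1 * of_int r = 0"
  shows "(\<exists>lact. is_left_action h \<epsilon> r lam0 lam1 lact) \<and>
         (\<exists>ract. is_right_action h' \<epsilon>' r' mu0 mu1 ract) \<and>
         (\<forall>lact ract.
            is_left_action h \<epsilon> r lam0 lam1 lact \<longrightarrow>
            is_right_action h' \<epsilon>' r' mu0 mu1 ract \<longrightarrow>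
            algebra_bimodule (C_alg h) (C_scalar h) (C_alg h') (C_scalar h')
              test_functions lact ract)"
proof (intro conjI allI impI)
  show "\<exists>lact. is_left_action h \<epsilon> r lam0 lam1 lact"
    using left_action_exists assms(1) by blast
  show "\<exists>ract. is_right_action h' \<epsilon>' r' mu0 mu1 ract"
    using right_action_exists assms(2) by blast
  fix lact ract
  assume l: "is_left_action h \<epsilon> r lam0 lam1 lact"
    and r: "is_right_action h' \<epsilon>' r' mu0 mu1 ract"
  let ?S = "gen_op \<epsilon> r lam0 lam1" and ?T = "gen_op \<epsilon>' r' mu0 mu1"
  interpret left: left_algebra_module "C_alg h" "C_scalar h" test_functions lact
    using l by (simp add: is_left_action_def)
  interpret right: right_algebra_module "C_alg h'" "C_scalar h'" test_functions ract
    using r by (simp add: is_right_action_def)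
  have lact: "lact (C_class h p) \<xi> = free_act (foldr ?S) p \<xi>" if "\<xi> \<in> test_functions" for p \<xi>
    using l prescribed_operators_unique[of \<epsilon> r lam0 lam1] that
    by (intro left_action_unique[OF left.left_algebra_module_axioms]) (auto simp: is_left_action_def)
  have ract: "ract \<xi> (C_class h' q) = free_act (fold ?T) q \<xi>" if "\<xi> \<in> test_functions" for q \<xi>
    using r prescribed_operators_unique[of \<epsilon>' r' mu0 mu1] that
    by (intro right_action_unique[OF right.right_algebra_module_axioms]) (auto simp: is_right_action_def)
  show "algebra_bimodule (C_alg h) (C_scalar h) (C_alg h') (C_scalar h') test_functions lact ract"
  proof
    fix a b \<xi>
    assume ab: "a \<in> carrier (C_alg h)" "b \<in> carrier (C_alg h')" and \<xi>: "\<xi> \<in> test_functions"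
    then obtain p q where pq: "a = C_class h p" "b = C_class h' q" by (auto simp: carrier_C_alg)
    have "free_act (foldr ?S) p (free_act (fold ?T) q \<xi>) = free_act (fold ?T) q (free_act (foldr ?S) p \<xi>)"
      using assms(3,4)
      by (intro free_act_commute foldr_fold_commute gen_op_commute linear_foldr linear_fold linear_gen_op)
    \<comment> \<open>The formulas \<open>lact\<close> and \<open>ract\<close> hold on test
      functions only, so closure under both actions is needed for the inner results.\<close>
    then show "lact a (ract \<xi> b) = ract (lact a \<xi>) b"
      using \<xi> ab left.lact_closed[of a \<xi>] right.ract_closed[of b \<xi>] by (simp add: pq lact ract)
  qed
qed

end
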